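(* Consider a mapping $F:\mathbb{R}^n\times\mathbb{R}^m\rightrightarrows\mathbb{R}^l$ and let $S(x):=\{y\in\mathbb{R}^m : 0\in F(x,y)\}$, $x\in\mathbb{R}^n$. Let $(\bar x,\bar y)\in\mathrm{gph}\,S$ be such that the implication $(0,0)\in D^*F(\bar x,\bar y,0)(z^* )\Rightarrow z^*=0$ holds. Assume that there is an open neighborhood $\Omega\times V$ of $(\bar x,\bar y)$ such that $\mathrm{gph}\,S\cap(\Omega\times V)$ is the graph of a continuous mapping $\sigma:\Omega\to\mathbb{R}^m$. Further assume that the strengthened qualification condition $$(x^*,0)\in D^*F(\bar x,\bar y,0)(z^* )\ \Rightarrow\ z^*=0,\ x^*=0$$ holds. Then there is some open neighborhood $U$ of $\bar x$ such that $\sigma$ is Lipschitz continuous on $U$. If, in addition, $F$ is semismooth$^*$ at $(x,\sigma(x),0)$ for some $x\in U$, then for every function $\varphi:\mathbb{R}^n\times\mathbb{R}^m\to\mathbb{R}$ which is semismooth at $(x,\sigma(x))$ with respect to some mapping $\Phi:\mathbb{R}^n\times\mathbb{R}^m\rightrightarrows\mathbb{R}^{1\times(n+m)}$, the mapping $\theta:U\to\mathbb{R}$, $\theta(u):=\varphi(u,\sigma(u))$, is semismooth at $x$ with respect to the mapping $\Theta:\mathbb{R}^n\rightrightarrows\mathbb{R}^{1\times n}$ given by $$\Theta(u):=\{g_x^T+{x^*}^T : x^*\in\Sigma(u,\sigma(u))(g_y),\ (g_x^T,g_y^T)\in\Phi(u,\sigma(u))\},\quad u\in\mathrm{dom}\,\Theta:=U,$$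 where $\Sigma(u,v)(y^* ):=\{x^* : \exists z^*\in\mathbb{R}^l\text{ with }(x^*,-y^* )\in D^*F(u,v,0)(z^* )\}$.
   Context: For a multifunction $G:\mathbb{R}^p\rightrightarrows\mathbb{R}^q$: $\mathrm{gph}\,G=\{(x,y) : y\in G(x)\}$, $\mathrm{dom}\,G=\{x : G(x)\neq\emptyset\}$. For a set $C\subset\mathbb{R}^s$ and $z\in C$: tangent cone $T_C(z)=\{w : \exists t_k\downarrow0,\ w_k\to w,\ z+t_kw_k\in C\}$; regular normal cone $\widehat N_C(z)=(T_C(z))^\circ$ (negative polar cone); limiting normal cone $N_C(\bar z)=\{z^* : \exists z_k\to\bar z,\ z_k\in C,\ z_k^*\in\widehat N_C(z_k),\ z_k^*\to z^*\}$. The limiting coderivative of $G$ at $(\bar x,\bar y)\in\mathrm{gph}\,G$ is the multifunction $D^*G(\bar x,\bar y):\mathbb{R}^q\rightrightarrows\mathbb{R}^p$ with $x^*\in D^*G(\bar x,\bar y)(y^* )$ iff $(x^*,-y^* )\in N_{\mathrm{gph}\,G}(\bar x,\bar y)$. For $F:\mathbb{R}^n\times\mathbb{R}^m\rightrightarrows\mathbb{R}^l$, $D^*F(x,y,z)$ maps $\mathbb{R}^l$ into subsets of $\mathbb{R}^n\times\mathbb{R}^m$. $G$ is semismooth$^*$ at $(\bar x,\bar y)\in\mathrm{gph}\,G$ if for every $\epsilon>0$ there is $\delta>0$ such that $|\langle x^*,x-\bar x\rangle-\langle y^*,y-\bar y\rangle|\le\epsilon\|(x,y)-(\bar x,\bar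 y)\|\,\|(y^*,x^* )\|$ for all $(x,y)\in\mathrm{gph}\,G$ with $\|(x,y)-(\bar x,\bar y)\|\le\delta$ and all $(y^*,x^* )\in\mathrm{gph}\,D^*G(x,y)$. A mapping $f:\Omega'\to\mathbb{R}^q$ ($\Omega'\subset\mathbb{R}^p$ open) is semismooth with respect to a multifunction $\Psi:\mathbb{R}^p\rightrightarrows\mathbb{R}^{q\times p}$ at $\bar u\in\Omega'$ if $\mathrm{dom}\,\Psi$ is a neighborhood of $\bar u$, $\Psi$ is locally bounded at $\bar u$ (its values are uniformly bounded on a neighborhood of $\bar u$), and $\lim_{u\to\bar u,\,u\in\Omega',\,u\ne\bar u}\sup\{\|f(u)-f(\bar u)-A(u-\bar u)\| : A\in\Psi(u)\}/\|u-\bar u\|=0$. Here $g_x\in\mathbb{R}^n$, $g_y\in\mathbb{R}^m$ are column vectors, and elements of $\Phi$, $\Theta$ are row vectors.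
   Formalization: The graph of F is additionally assumed locally closed at (x̄,ȳ,0); without this the claim fails, e.g. gph F = {z≠0} ∪ {(x,√|x|,0)}, where all normal cones are {0} but σ(x)=√|x| is not Lipschitz near 0. *)

theory Defs
  imports "HOL-Analysis.Analysis"
begin

text \<open>
  A multifunction is a set-valued function. Spaces \<open>\<real>\<^sup>n\<close> carry the Euclidean norm, and so do the
  product types, whose library inner product and norm are those of \<open>\<real>\<^sup>p \<times> \<real>\<^sup>q = \<real>\<^sup>p\<^sup>+\<^sup>q\<close>.
\<close>

definition gph :: "('a \<Rightarrow> 'b set) \<Rightarrow> ('a \<times> 'b) set" where
  "gph G = {(x, y). y \<in> G x}"

definition mdom :: "('a \<Rightarrow> 'b set) \<Rightarrow> 'a set" where
  "mdom G = {x. G x \<noteq> {}}"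

definition tangent_cone :: "'a::euclidean_space set \<Rightarrow> 'a \<Rightarrow> 'a set" where
  "tangent_cone C z =
     {w. \<exists>(t :: nat \<Rightarrow> real) wk. (\<forall>k. t k > 0) \<and> t \<longlonglongrightarrow> 0 \<and> wk \<longlonglongrightarrow> w \<and>
           (\<forall>k. z + t k *\<^sub>R wk k \<in> C)}"

definition polar_cone :: "'a::euclidean_space set \<Rightarrow> 'a set" where
  "polar_cone K = {v. \<forall>w\<in>K. v \<bullet> w \<le> 0}"

definition regular_normal_cone :: "'a::euclidean_space set \<Rightarrow> 'a \<Rightarrow> 'a set" where
  "regular_normal_cone C z = polar_cone (tangent_cone C z)"

definition limiting_normal_cone :: "'a::euclidean_space set \<Rightarrow> 'a \<Rightarrow> 'a set" where
  "limiting_normal_cone C z =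
     {zs. \<exists>zk zsk. zk \<longlonglongrightarrow> z \<and> (\<forall>k. zk k \<in> C) \<and>
            (\<forall>k. zsk k \<in> regular_normal_cone C (zk k)) \<and> zsk \<longlonglongrightarrow> zs}"

definition coderivative ::
  "('a::euclidean_space \<Rightarrow> 'b::euclidean_space set) \<Rightarrow> 'a \<Rightarrow> 'b \<Rightarrow> 'b \<Rightarrow> 'a set" where
  "coderivative G x y ys = {xs. (xs, - ys) \<in> limiting_normal_cone (gph G) (x, y)}"

definition semismooth_star ::
  "('a::euclidean_space \<Rightarrow> 'b::euclidean_space set) \<Rightarrow> 'a \<Rightarrow> 'b \<Rightarrow> bool" where
  "semismooth_star G xb yb \<longleftrightarrow>
     (xb, yb) \<in> gph G \<and>
     (\<forall>\<epsilon>>0. \<exists>\<delta>>0. \<forall>x y. (x, y) \<in> gph G \<and> norm ((x, y) - (xb, yb)) \<le> \<delta> \<longrightarrow>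
        (\<forall>ys xs. (ys, xs) \<in> gph (coderivative G x y) \<longrightarrow>
           \<bar>xs \<bullet> (x - xb) - ys \<bullet> (y - yb)\<bar> \<le> \<epsilon> * norm ((x, y) - (xb, yb)) * norm (ys, xs)))"

text \<open>
  Matrices in \<open>\<real>\<^sup>q\<^sup>\<times>\<^sup>p\<close> are the linear maps \<open>\<real>\<^sup>p \<rightarrow> \<real>\<^sup>q\<close>; boundedness of a set of matrices does not
  depend on the norm. The function \<open>f\<close> matters only on \<open>D\<close>. The real-valued supremum is meaningful
  in the limit because, by the preceding two conjuncts, near \<open>ub\<close> it is taken over
  nonempty bounded sets.
\<close>

definition locally_bounded_at ::
  "('a::metric_space \<Rightarrow> 'b::metric_space set) \<Rightarrow> 'a \<Rightarrow> bool" where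
  "locally_bounded_at \<Psi> ub \<longleftrightarrow> (\<exists>N. open N \<and> ub \<in> N \<and> bounded (\<Union>u\<in>N. \<Psi> u))"

definition semismooth_wrt ::
  "'a::euclidean_space set \<Rightarrow> ('a \<Rightarrow> 'b::euclidean_space) \<Rightarrow> ('a \<Rightarrow> ('a \<Rightarrow>\<^sub>L 'b) set) \<Rightarrow> 'a \<Rightarrow> bool" where
  "semismooth_wrt D f \<Psi> ub \<longleftrightarrow>
     open D \<and> ub \<in> D \<and>
     ub \<in> interior (mdom \<Psi>) \<and>
     locally_bounded_at \<Psi> ub \<and>
     ((\<lambda>u. (SUP A\<in>\<Psi> u. norm (f u - f ub - blinfun_apply A (u - ub))) / norm (u - ub)) \<longlongrightarrow> 0)
       (at ub within D)"

definition solution_map :: "('a \<times> 'b \<Rightarrow> 'c::zero set) \<Rightarrow> 'a \<Rightarrow> 'b set" where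
  "solution_map F x = {y. 0 \<in> F (x, y)}"

definition Sigma_map ::
  "('a::euclidean_space \<times> 'b::euclidean_space \<Rightarrow> 'c::euclidean_space set) \<Rightarrow> 'a \<Rightarrow> 'b \<Rightarrow> 'b \<Rightarrow> 'a set"
  where
  "Sigma_map F u v ys = {xs. \<exists>zs. (xs, - ys) \<in> coderivative F (u, v) 0 zs}"

text \<open>
  The row vector \<open>g\<^sup>T\<close> is the functional \<open>blinfun_inner_right g\<close>, that is \<open>\<lambda>h. g \<bullet> h\<close>; in particular
  \<open>blinfun_inner_right (gx, gy)\<close> is the functional \<open>\<lambda>(h, k). gx \<bullet> h + gy \<bullet> k\<close>. Since \<open>\<Theta>\<close> is only
  defined on \<open>U\<close>, its values outside \<open>U\<close> are empty.
\<close>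

definition Theta_map ::
  "('a::euclidean_space \<times> 'b::euclidean_space \<Rightarrow> 'c::euclidean_space set) \<Rightarrow> ('a \<Rightarrow> 'b) \<Rightarrow>
   ('a \<times> 'b \<Rightarrow> (('a \<times> 'b) \<Rightarrow>\<^sub>L real) set) \<Rightarrow> 'a set \<Rightarrow> 'a \<Rightarrow> ('a \<Rightarrow>\<^sub>L real) set" where
  "Theta_map F \<sigma> \<Phi> U u =
     (if u \<in> U then
        {blinfun_inner_right gx + blinfun_inner_right xs | gx gy xs.
           xs \<in> Sigma_map F u (\<sigma> u) gy \<and> blinfun_inner_right (gx, gy) \<in> \<Phi> (u, \<sigma> u)}
      else {})"

text \<open>
  The limiting normal cone only detects the local geometry of a set that is closed near the point:
  for the graph \<open>{(x, y, z). z \<noteq> 0} \<union> {(x, \<sigma> x, 0) | x. True}\<close> in \<open>\<real>\<^sup>3\<close> all normal cones are \<open>{0}\<close>,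
  whatever the function \<open>\<sigma>\<close> is.
\<close>

definition locally_closed_at :: "'a::metric_space set \<Rightarrow> 'a \<Rightarrow> bool" where
  "locally_closed_at C z \<longleftrightarrow> (\<exists>r>0. closed (C \<inter> cball z r))"

end

theory Submission
  imports Defs
begin

text \<open>
  Write \<open>C\<close> for the graph of \<open>F\<close>, split vectors of the ambient space into an \<open>(x, z)\<close> part and a
  \<open>y\<close> part, and let \<open>w\<^sub>0 = (x\<^sub>0, y\<^sub>0, 0)\<close> be the reference point. By compactness, the strengthened
  qualification condition says that near \<open>w\<^sub>0\<close> all normals to \<open>C\<close> have their \<open>(x, z)\<close> part bounded
  by a multiple \<open>\<kappa>\<close> of their \<open>y\<close> part. This estimate is used three times, with normals produced as
  negative gradients at minimisers over \<open>C\<close>.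

  Lipschitz continuity: for \<open>w \<in> C\<close> near \<open>w\<^sub>0\<close> and a target \<open>q\<close>, minimise the distance of the \<open>(x, z)\<close>
  part to \<open>q\<close> plus a small smooth penalty for leaving \<open>w\<close>. If the distance were positive at the minimiser,
  the normal there would have an \<open>(x, z)\<close> part of size about 1 and a tiny \<open>y\<close> part. So \<open>q\<close> is attained
  at a distance proportional to the initial gap.

  Nonemptiness of \<open>\<Sigma>\<close>: minimising \<open>- \<langle>v, y\<rangle>\<close> plus a growing quadratic penalty on the \<open>(x, z)\<close> part gives
  normals with \<open>y\<close> part exactly \<open>v\<close>; their \<open>(x, z)\<close> parts stay bounded, so they accumulate.

  Semismoothness: for \<open>g\<^sub>x + x\<^sup>* \<in> \<Theta> u\<close>, the error of \<open>\<theta>\<close> is the error of \<open>\<phi>\<close> for \<open>(g\<^sub>x, g\<^sub>y)\<close> minus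
  \<open>\<langle>x\<^sup>*, u - x\<rangle> - \<langle>g\<^sub>y, \<sigma> u - \<sigma> x\<rangle>\<close>, and the latter is small by the semismoothness\<open>\<^sup>*\<close> of \<open>F\<close>.
\<close>

section \<open>Regular normals and local minimisers\<close>

lemma regular_normal_cone_scaleR:
  assumes "\<nu> \<in> regular_normal_cone C w" "0 \<le> c"
  shows "c *\<^sub>R \<nu> \<in> regular_normal_cone C w"
  using assms by (simp add: regular_normal_cone_def polar_cone_def mult_nonneg_nonpos)

text \<open>First-order expansion along a tangent sequence in \<open>C\<close>: the increments of
  \<open>h\<close> are nonnegative by minimality, and dividing them by \<open>t k\<close> gives
  \<open>0 \<le> d \<bullet> g\<close> in the limit.\<close>

lemma regular_normal_at_local_min:
  fixes C :: "'a::euclidean_space set"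
  assumes deriv: "GDERIV h w :> g" and "0 < r"
    and min: "\<And>w'. w' \<in> C \<Longrightarrow> dist w' w < r \<Longrightarrow> h w \<le> h w'"
  shows "- g \<in> regular_normal_cone C w"
  unfolding regular_normal_cone_def polar_cone_def mem_Collect_eq
proof
  fix d assume "d \<in> tangent_cone C w"
  then obtain t :: "nat \<Rightarrow> real" and dk where t: "\<And>k. t k > 0" "t \<longlonglongrightarrow> 0"
    and dk: "dk \<longlonglongrightarrow> d" and inC: "\<And>k. w + t k *\<^sub>R dk k \<in> C"
    by (auto simp: tangent_cone_def)
  have step: "(\<lambda>k. t k *\<^sub>R dk k) \<longlonglongrightarrow> 0"
    using tendsto_scaleR[OF t(2) dk] by simp
  \<comment> \<open>The slack \<open>e * norm d\<close> absorbs the first-order remainder, which is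
    at most \<open>e\<close> times the step length.\<close>
  have "0 \<le> d \<bullet> g + e * norm d" if "e > 0" for e
  proof -
    obtain \<delta> where \<delta>: "\<delta> > 0"
      "\<And>y. norm (y - w) < \<delta> \<Longrightarrow> \<bar>h y - h w - (y - w) \<bullet> g\<bar> \<le> e * norm (y - w)"
      using deriv \<open>e > 0\<close> unfolding gderiv_def has_derivative_at_alt by fastforce
    have "\<forall>\<^sub>F k in sequentially. norm (t k *\<^sub>R dk k) < min \<delta> r"
      using tendstoD[OF step, of "min \<delta> r"] \<delta>(1) \<open>0 < r\<close> by simp
    then have "\<forall>\<^sub>F k in sequentially. 0 \<le> dk k \<bullet> g + e * norm (dk k)"
    proof eventually_elim
      case (elim k)
      have "h w \<le> h (w + t k *\<^sub>R dk k)"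
        using min[OF inC] elim by (simp add: dist_norm)
      then have "0 \<le> t k * (dk k \<bullet> g) + e * (t k * norm (dk k))"
        using \<delta>(2)[of "w + t k *\<^sub>R dk k"] elim t(1)[of k] by simp
      then have "0 \<le> t k * (dk k \<bullet> g + e * norm (dk k))"
        by (simp add: algebra_simps)
      then show ?case
        using t(1)[of k] by (simp add: zero_le_mult_iff)
    qed
    moreover have "(\<lambda>k. dk k \<bullet> g + e * norm (dk k)) \<longlonglongrightarrow> d \<bullet> g + e * norm d"
      by (intro tendsto_intros dk)
    ultimately show ?thesis
      by (intro tendsto_lowerbound[of "\<lambda>k. dk k \<bullet> g + e * norm (dk k)"]) auto
  qed
  note lower = this
  have "0 \<le> d \<bullet> g + e" if "e > 0" for e
  proof -
    \<comment> \<open>Dividing by \<open>norm d + 1\<close> removes the factor \<open>norm d\<close>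
      from the slack and also covers \<open>d = 0\<close>.\<close>
    have "e / (norm d + 1) * norm d \<le> e"
      using that by (simp add: add_nonneg_pos divide_simps mult_left_mono)
    then show ?thesis
      using lower[of "e / (norm d + 1)"] that by (simp add: add_nonneg_pos)
  qed
  then have "0 \<le> d \<bullet> g"
    by (rule field_le_epsilon)
  then show "- g \<bullet> d \<le> 0"
    by (simp add: inner_commute)
qed

section \<open>Splitting the ambient space into (x, z) and y coordinates\<close>

definition xz_part :: "('a \<times> 'b) \<times> 'c \<Rightarrow> 'a \<times> 'c" where
  "xz_part w = (fst (fst w), snd w)"

definition y_part :: "('a \<times> 'b) \<times> 'c \<Rightarrow> 'b" where
  "y_part w = snd (fst w)"

lemma xz_part_simps [simp]: "xz_part ((a, b), c) = (a, c)"
  by (simp add: xz_part_def)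

lemma xz_part_0 [simp]: "xz_part 0 = 0"
  by (simp add: xz_part_def zero_prod_def)

lemma y_part_simps [simp]: "y_part ((a, b), c) = b"
  by (simp add: y_part_def)

lemma bounded_linear_xz_part: "bounded_linear xz_part"
  unfolding xz_part_def
  by (intro bounded_linear_Pair bounded_linear_compose[OF bounded_linear_fst bounded_linear_fst]
      bounded_linear_snd)

lemma bounded_linear_y_part: "bounded_linear y_part"
  unfolding y_part_def
  by (rule bounded_linear_compose[OF bounded_linear_snd bounded_linear_fst])

lemmas xz_part_linear = bounded_linear.linear[OF bounded_linear_xz_part]
lemmas y_part_linear = bounded_linear.linear[OF bounded_linear_y_part]

lemma norm_xz_y:
  fixes w :: "('a::euclidean_space \<times> 'b::euclidean_space) \<times> 'c::euclidean_space"
  shows "(norm w)\<^sup>2 = (norm (xz_part w))\<^sup>2 + (norm (y_part w))\<^sup>2"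
  by (cases w, cases "fst w") (simp add: norm_Pair xz_part_def y_part_def)

lemma norm_xz_le: "norm (xz_part w) \<le> norm w"
  for w :: "('a::euclidean_space \<times> 'b::euclidean_space) \<times> 'c::euclidean_space"
  by (rule power2_le_imp_le) (use norm_xz_y[of w] in auto)

lemma norm_y_le: "norm (y_part w) \<le> norm w"
  for w :: "('a::euclidean_space \<times> 'b::euclidean_space) \<times> 'c::euclidean_space"
  by (rule power2_le_imp_le) (use norm_xz_y[of w] in auto)

lemma norm_le_xz_y: "norm w \<le> norm (xz_part w) + norm (y_part w)"
  for w :: "('a::euclidean_space \<times> 'b::euclidean_space) \<times> 'c::euclidean_space"
  by (rule power2_le_imp_le) (use norm_xz_y[of w] in \<open>auto simp: power2_sum\<close>)

text \<open>The adjoint of \<open>xz_part\<close>; it turns gradients in the (x, z) variables into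
  gradients on the whole space.\<close>

definition xz_embed :: "'a \<times> 'c \<Rightarrow> ('a \<times> 'b::zero) \<times> 'c" where
  "xz_embed q = ((fst q, 0), snd q)"

lemma xz_part_embed [simp]: "xz_part (xz_embed q) = q" "y_part (xz_embed q) = 0"
  by (simp_all add: xz_embed_def)

lemma inner_xz_embed: "w \<bullet> xz_embed q = xz_part w \<bullet> q"
  for w :: "('a::euclidean_space \<times> 'b::euclidean_space) \<times> 'c::euclidean_space"
  by (simp add: xz_embed_def xz_part_def inner_prod_def)

section \<open>A uniform estimate for normals near the reference point\<close>

text \<open>The quantitative form of the qualification condition. It speaks of regular normals,
  since these are what minimisers produce.\<close>

definition normals_bounded_by_y ::
  "(('a::euclidean_space \<times> 'b::euclidean_space) \<times> 'c::euclidean_space) set \<Rightarrow> real \<Rightarrow>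
   ('a \<times> 'b) \<times> 'c \<Rightarrow> real \<Rightarrow> bool" where
  "normals_bounded_by_y C \<kappa> wb r \<longleftrightarrow>
    (\<forall>w\<in>C. dist w wb < r \<longrightarrow>
       (\<forall>\<nu>\<in>regular_normal_cone C w. norm (xz_part \<nu>) \<le> \<kappa> * norm (y_part \<nu>)))"

text \<open>If every constant failed, normals scaled to have (x, z) part of norm 1 would have
  vanishing y parts. A cluster point would be a nonzero limiting normal at \<open>wb\<close> with y
  part 0.\<close>

lemma obtain_normals_bounded_by_y:
  fixes C :: "(('a::euclidean_space \<times> 'b::euclidean_space) \<times> 'c::euclidean_space) set"
  assumes qc: "\<And>\<nu>. \<nu> \<in> limiting_normal_cone C wb \<Longrightarrow> y_part \<nu> = 0 \<Longrightarrow> \<nu> = 0"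
  obtains \<kappa> r where "0 < \<kappa>" "0 < r" "normals_bounded_by_y C \<kappa> wb r"
proof -
  \<comment> \<open>One index drives both the constant to infinity and the radius to 0.\<close>
  have "\<exists>k. normals_bounded_by_y C (Suc k) wb (inverse (Suc k))"
  proof (rule ccontr)
    assume "\<not> ?thesis"
    then have "\<forall>k. \<exists>w \<nu>. w \<in> C \<and> dist w wb < inverse (Suc k) \<and> \<nu> \<in> regular_normal_cone C w \<and>
        norm (xz_part \<nu>) > Suc k * norm (y_part \<nu>)"
      unfolding normals_bounded_by_y_def by (meson not_le)
    then obtain w \<nu> where w: "\<And>k. w k \<in> C" "\<And>k. dist (w k) wb < inverse (Suc k)"
      and \<nu>: "\<And>k. \<nu> k \<in> regular_normal_cone C (w k)"
      and big: "\<And>k. norm (xz_part (\<nu> k)) > Suc k * norm (y_part (\<nu> k))"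
      by metis
    have pos: "norm (xz_part (\<nu> k)) > 0" for k
      using big[of k] by (smt (verit) mult_nonneg_nonneg norm_ge_zero of_nat_0_le_iff)
    define \<mu> where "\<mu> k = inverse (norm (xz_part (\<nu> k))) *\<^sub>R \<nu> k" for k
    have \<mu>: "\<mu> k \<in> regular_normal_cone C (w k)" for k
      unfolding \<mu>_def by (intro regular_normal_cone_scaleR \<nu>) simp
    have xz1: "norm (xz_part (\<mu> k)) = 1" for k
      using pos[of k] by (simp add: \<mu>_def linear_cmul[OF xz_part_linear])
    have ysmall: "norm (y_part (\<mu> k)) \<le> inverse (Suc k)" for k
      using big[of k] pos[of k]
      by (simp add: \<mu>_def linear_cmul[OF y_part_linear] divide_simps mult.commute less_imp_le)
    have "norm (\<mu> k) \<le> 2" for k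
    proof -
      have "inverse (real (Suc k)) \<le> 1"
        by (simp add: divide_simps)
      then show ?thesis
        using norm_le_xz_y[of "\<mu> k"] xz1[of k] ysmall[of k] by linarith
    qed
    then have "bounded (range \<mu>)"
      by (auto simp: bounded_iff)
    then obtain l s where s: "strict_mono s" and lim: "(\<mu> \<circ> s) \<longlonglongrightarrow> l"
      using bounded_imp_convergent_subsequence by blast
    have "(\<lambda>k. dist (w k) wb) \<longlonglongrightarrow> 0"
      using w(2) by (intro Lim_null_comparison[OF always_eventually LIMSEQ_inverse_real_of_nat])
        (auto intro: less_imp_le)
    then have "w \<longlonglongrightarrow> wb"
      by (subst tendsto_dist_iff)
    then have "(w \<circ> s) \<longlonglongrightarrow> wb"
      using s by (rule LIMSEQ_subseq_LIMSEQ)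
    then have "l \<in> limiting_normal_cone C wb"
      using lim w(1) \<mu> unfolding limiting_normal_cone_def by (fastforce simp: o_def)
    moreover have "(\<lambda>k. y_part (\<mu> k)) \<longlonglongrightarrow> 0"
      using ysmall by (intro Lim_null_comparison[OF always_eventually LIMSEQ_inverse_real_of_nat]) auto
    then have "((\<lambda>k. y_part (\<mu> k)) \<circ> s) \<longlonglongrightarrow> 0"
      using s by (rule LIMSEQ_subseq_LIMSEQ)
    then have "y_part l = 0"
      using bounded_linear.tendsto[OF bounded_linear_y_part lim]
      by (intro LIMSEQ_unique) (auto simp: o_def)
    moreover have "norm (xz_part l) = 1"
      using tendsto_norm[OF bounded_linear.tendsto[OF bounded_linear_xz_part lim]]
      by (simp add: xz1 LIMSEQ_const_iff)
    ultimately show False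
      using qc[of l] by auto
  qed
  then show ?thesis
    using that by (metis inverse_positive_iff_positive of_nat_0_less_iff zero_less_Suc)
qed

text \<open>The inequality is closed under limits and the ball is open, so the estimate passes to
  limiting normals, from which coderivatives are built.\<close>

lemma limiting_normal_bound:
  fixes C :: "(('a::euclidean_space \<times> 'b::euclidean_space) \<times> 'c::euclidean_space) set"
  assumes bound: "normals_bounded_by_y C \<kappa> wb r"
    and \<nu>: "\<nu> \<in> limiting_normal_cone C w" and "dist w wb < r"
  shows "norm (xz_part \<nu>) \<le> \<kappa> * norm (y_part \<nu>)"
proof -
  obtain wk \<nu>k where wk: "wk \<longlonglongrightarrow> w" "\<And>k. wk k \<in> C"
    and \<nu>k: "\<And>k. \<nu>k k \<in> regular_normal_cone C (wk k)" "\<nu>k \<longlonglongrightarrow> \<nu>"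
    using \<nu> unfolding limiting_normal_cone_def mem_Collect_eq by metis
  have "\<forall>\<^sub>F k in sequentially. dist (wk k) wb < r"
    using tendsto_dist[OF wk(1) tendsto_const] \<open>dist w wb < r\<close> by (rule order_tendstoD(2))
  then have "\<forall>\<^sub>F k in sequentially. norm (xz_part (\<nu>k k)) \<le> \<kappa> * norm (y_part (\<nu>k k))"
  proof eventually_elim
    case (elim k)
    show ?case
      using bound[unfolded normals_bounded_by_y_def, rule_format, OF wk(2) elim \<nu>k(1)] .
  qed
  with _ _ show ?thesis
  proof (rule tendsto_le[OF sequentially_bot])
    show "(\<lambda>k. norm (xz_part (\<nu>k k))) \<longlonglongrightarrow> norm (xz_part \<nu>)"
      by (intro tendsto_norm bounded_linear.tendsto[OF bounded_linear_xz_part] \<nu>k(2))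
    show "(\<lambda>k. \<kappa> * norm (y_part (\<nu>k k))) \<longlonglongrightarrow> \<kappa> * norm (y_part \<nu>)"
      by (intro tendsto_mult_left tendsto_norm bounded_linear.tendsto[OF bounded_linear_y_part] \<nu>k(2))
  qed
qed

section \<open>Metric regularity of the projection onto the (x, z) coordinates\<close>

text \<open>Where the gap to \<open>q\<close> is positive, its gradient is a unit vector in the (x,
  z) variables. By the estimate for normals, only a penalty gradient of norm at least
  \<open>1 / (1 + \<kappa>)\<close> could balance it. The modulus obtained is
  \<open>1 / \<epsilon> = 4 * (1 + \<kappa>)\<close>.\<close>

lemma projection_metric_regular:
  fixes C :: "(('a::euclidean_space \<times> 'b::euclidean_space) \<times> 'c::euclidean_space) set"
  assumes cl: "closed (C \<inter> cball wb R)" "0 < R"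
    and bound: "normals_bounded_by_y C \<kappa> wb r0" "0 < \<kappa>" "0 < r0"
  obtains M s where "0 < M" "0 < s"
    "\<And>w0 q. w0 \<in> C \<Longrightarrow> dist w0 wb < s \<Longrightarrow> norm (xz_part w0 - q) < s \<Longrightarrow>
       \<exists>w1\<in>C. xz_part w1 = q \<and> dist w1 w0 \<le> M * norm (xz_part w0 - q)"
proof -
  define r where "r = min R r0"
  have r: "0 < r" "r \<le> R" "r \<le> r0"
    using \<open>0 < R\<close> \<open>0 < r0\<close> by (auto simp: r_def)
  \<comment> \<open>The penalty gradient will have norm at most \<open>2 * \<epsilon>\<close>, and
    \<open>2 * \<epsilon> * (1 + \<kappa>)\<close> is 1/2, below the threshold 1.\<close>
  define \<epsilon> where "\<epsilon> = 1 / (4 * (1 + \<kappa>))"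
  have \<epsilon>: "0 < \<epsilon>" "\<epsilon> \<le> 1" "\<epsilon> * (1 + \<kappa>) = 1 / 4"
    using \<open>0 < \<kappa>\<close> by (auto simp: \<epsilon>_def)
  define K where "K = C \<inter> cball wb r"
  have "K = (C \<inter> cball wb R) \<inter> cball wb r"
    using r by (auto simp: K_def)
  then have K: "compact K"
    using closed_Int_compact[OF cl(1) compact_cball, of wb r] by simp
  \<comment> \<open>With the radius \<open>\<epsilon> * r / 2\<close>, both
    \<open>dist w0 wb\<close> and the displacement \<open>\<rho> / \<epsilon>\<close> stay below
    \<open>r / 2\<close>, so the minimiser lies in the open ball of radius \<open>r\<close>.\<close>
  have "\<exists>w1\<in>C. xz_part w1 = q \<and> dist w1 w0 \<le> (1 / \<epsilon>) * norm (xz_part w0 - q)"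
    if w0: "w0 \<in> C" "dist w0 wb < \<epsilon> * r / 2" and q: "norm (xz_part w0 - q) < \<epsilon> * r / 2" for w0 q
  proof (cases "xz_part w0 = q")
    case True
    then show ?thesis
      using w0 by (intro bexI[of _ w0]) auto
  next
    case False
    define \<rho> where "\<rho> = norm (xz_part w0 - q)"
    have \<rho>: "0 < \<rho>" "\<rho> < \<epsilon> * r / 2"
      using False q by (auto simp: \<rho>_def)
    \<comment> \<open>The weight of the penalty is tuned so that the minimiser is within \<open>\<rho> / \<epsilon>\<close> of \<open>w0\<close> and the
      penalty still has gradient at most \<open>2 * \<epsilon>\<close> there.\<close>
    define c where "c = \<epsilon>\<^sup>2 / \<rho>"
    have c: "c * \<rho> = \<epsilon>\<^sup>2" "0 < c"
      using \<rho> \<epsilon> by (auto simp: c_def)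
    define h where "h w = norm (xz_part w - q) + c * ((w - w0) \<bullet> (w - w0))" for w
    have "\<epsilon> * r \<le> r"
      using \<epsilon> r by simp
    then have w0r: "dist w0 wb < r / 2"
      using w0(2) by simp
    then have "w0 \<in> K"
      using w0(1) r(1) by (simp add: K_def dist_commute)
    moreover have "continuous_on K h"
      unfolding h_def by (intro continuous_intros linear_continuous_on bounded_linear_xz_part)
    ultimately obtain w1 where w1: "w1 \<in> K" and min: "\<And>w. w \<in> K \<Longrightarrow> h w1 \<le> h w"
      using continuous_attains_inf[OF K] by blast
    have "h w0 = \<rho>"
      by (simp add: h_def \<rho>_def)
    \<comment> \<open>Comparison with the competitor \<open>w0\<close>; multiplying by
      \<open>\<rho>\<close> and using \<open>c * \<rho> = \<epsilon>\<^sup>2\<close> then bounds the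
      displacement.\<close>
    then have "c * (norm (w1 - w0))\<^sup>2 \<le> \<rho>"
      using min[OF \<open>w0 \<in> K\<close>] norm_ge_zero[of "xz_part w1 - q"]
      unfolding h_def power2_norm_eq_inner by linarith
    then have "c * (norm (w1 - w0))\<^sup>2 * \<rho> \<le> \<rho> * \<rho>"
      using \<rho>(1) by (intro mult_right_mono) auto
    moreover have "c * (norm (w1 - w0))\<^sup>2 * \<rho> = (\<epsilon> * norm (w1 - w0))\<^sup>2"
      using c by (simp add: power_mult_distrib algebra_simps)
    ultimately have "(\<epsilon> * norm (w1 - w0))\<^sup>2 \<le> \<rho>\<^sup>2"
      by (simp only: power2_eq_square[of \<rho>])
    then have close: "\<epsilon> * norm (w1 - w0) \<le> \<rho>"
      using \<rho>(1) by (auto dest: power2_le_imp_le)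
    then have dist1: "dist w1 w0 \<le> (1 / \<epsilon>) * \<rho>"
      using \<epsilon>(1) by (simp add: dist_norm field_simps)
    have "\<epsilon> * dist w1 w0 < \<epsilon> * (r / 2)"
      using close \<rho>(2) by (simp add: dist_norm)
    then have "dist w1 w0 < r / 2"
      using \<epsilon>(1) mult_less_cancel_left_pos by blast
    then have w1r: "dist w1 wb < r"
      using w0r dist_triangle[of w1 wb w0] by linarith
    have "xz_part w1 = q"
    proof (rule ccontr)
      assume "xz_part w1 \<noteq> q"
      \<comment> \<open>\<open>xz_embed v\<close> and \<open>e\<close> are the gradients at
        \<open>w1\<close> of the distance term and of the penalty.\<close>
      define v where "v = sgn (xz_part w1 - q)"
      define e where "e = (2 * c) *\<^sub>R (w1 - w0)"
      have "norm v = 1"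
        using \<open>xz_part w1 \<noteq> q\<close> by (simp add: v_def norm_sgn)
      have "((\<lambda>w. xz_part w - q) has_derivative xz_part) (at w1)"
        by (auto intro!: derivative_eq_intros bounded_linear_imp_has_derivative bounded_linear_xz_part)
      then have "((\<lambda>w. norm (xz_part w - q)) has_derivative (\<lambda>d. xz_part d \<bullet> v)) (at w1)"
        unfolding v_def
        by (rule has_derivative_compose[OF _ has_derivative_norm]) (simp add: \<open>xz_part w1 \<noteq> q\<close>)
      then have "(h has_derivative (\<lambda>d. xz_part d \<bullet> v + c * ((w1 - w0) \<bullet> d + d \<bullet> (w1 - w0)))) (at w1)"
        unfolding h_def by (auto intro!: derivative_eq_intros)
      then have "GDERIV h w1 :> xz_embed v + e"
        unfolding gderiv_def
        by (rule has_derivative_eq_rhs)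
          (simp add: fun_eq_iff inner_add_right inner_xz_embed e_def inner_commute algebra_simps)
      then have "- (xz_embed v + e) \<in> regular_normal_cone C w1"
      proof (rule regular_normal_at_local_min)
        show "0 < r - dist w1 wb"
          using w1r by simp
        show "h w1 \<le> h w" if "w \<in> C" "dist w w1 < r - dist w1 wb" for w
          using that dist_triangle[of w wb w1] by (intro min) (auto simp: K_def dist_commute)
      qed
      then have "norm (xz_part (- (xz_embed v + e))) \<le> \<kappa> * norm (y_part (- (xz_embed v + e)))"
        using bound(1) w1 w1r r(3) unfolding normals_bounded_by_y_def K_def by fastforce
      moreover have "xz_part (- (xz_embed v + e)) = - (v + xz_part e)"
        by (simp add: linear_neg[OF xz_part_linear] linear_add[OF xz_part_linear] del: minus_add_distrib)
      moreover have "y_part (- (xz_embed v + e)) = - y_part e"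
        by (simp add: linear_neg[OF y_part_linear] linear_add[OF y_part_linear] del: minus_add_distrib)
      ultimately have "norm (v + xz_part e) \<le> \<kappa> * norm (y_part e)"
        by (simp only: norm_minus_cancel)
      moreover have "1 \<le> norm (v + xz_part e) + norm (xz_part e)"
        using norm_triangle_ineq4[of "v + xz_part e" "xz_part e"] \<open>norm v = 1\<close> by simp
      moreover have ne: "norm e \<le> 2 * \<epsilon>"
      proof -
        have "norm e * \<rho> = 2 * \<epsilon> * (\<epsilon> * norm (w1 - w0))"
          using c by (simp add: e_def power2_eq_square)
        also have "\<dots> \<le> 2 * \<epsilon> * \<rho>"
          using close \<epsilon>(1) by (intro mult_left_mono) auto
        finally show ?thesis
          using \<rho>(1) by simp
      qed
      moreover have "\<kappa> * norm (y_part e) \<le> \<kappa> * (2 * \<epsilon>)"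
        using ne norm_y_le[of e] \<open>0 < \<kappa>\<close> by (intro mult_left_mono) auto
      ultimately have "1 \<le> 2 * (\<epsilon> * (1 + \<kappa>))"
        using norm_xz_le[of e] by (simp add: algebra_simps)
      then show False
        using \<epsilon>(3) by simp
    qed
    then show ?thesis
      using w1 dist1 unfolding K_def \<rho>_def by blast
  qed
  moreover have "0 < 1 / \<epsilon>" "0 < \<epsilon> * r / 2"
    using \<epsilon> r by auto
  ultimately show ?thesis
    using that by blast
qed

section \<open>Limiting normals with prescribed y part\<close>

definition y_embed :: "'b \<Rightarrow> ('a::zero \<times> 'b) \<times> 'c::zero" where
  "y_embed v = ((0, v), 0)"

lemma inner_y_embed: "w \<bullet> y_embed v = y_part w \<bullet> v"
  for w :: "('a::euclidean_space \<times> 'b::euclidean_space) \<times> 'c::euclidean_space"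
  by (simp add: y_embed_def y_part_def inner_prod_def)

text \<open>Only the linear term of the penalised function depends on y, so the normals at all
  minimisers have y part \<open>v\<close>. The growing penalty and \<open>unique\<close> force a
  subsequence of minimisers to \<open>wb\<close>, and \<open>bound\<close> makes the normals there
  cluster.\<close>

lemma limiting_normal_with_y_part:
  fixes C :: "(('a::euclidean_space \<times> 'b::euclidean_space) \<times> 'c::euclidean_space) set"
  assumes cl: "closed (C \<inter> cball wb R)" "0 < R" and "wb \<in> C"
    and bound: "normals_bounded_by_y C \<kappa> wb r0" "0 < r0"
    and unique: "\<And>w. w \<in> C \<Longrightarrow> dist w wb \<le> R \<Longrightarrow> xz_part w = xz_part wb \<Longrightarrow> w = wb"
  shows "\<exists>\<nu>\<in>limiting_normal_cone C wb. y_part \<nu> = v"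
proof -
  define q where "q = xz_part wb"
  define K where "K = C \<inter> cball wb R"
  have K: "compact K"
    using compact_Int_closed[OF compact_cball cl(1), of wb R] by (simp add: K_def Int_ac)
  define h where "h k w = real (Suc k) * ((xz_part w - q) \<bullet> (xz_part w - q)) - y_part w \<bullet> v" for k w
  have "wb \<in> K"
    using \<open>wb \<in> C\<close> \<open>0 < R\<close> by (simp add: K_def)
  have "continuous_on K (h k)" for k
    unfolding h_def
    by (intro continuous_intros linear_continuous_on bounded_linear_xz_part bounded_linear_y_part)
  then have "\<exists>w\<in>K. \<forall>w'\<in>K. h k w \<le> h k w'" for k
    using continuous_attains_inf[OF K] \<open>wb \<in> K\<close> by blast
  then obtain w where wK: "\<And>k. w k \<in> K" and min: "\<And>k w'. w' \<in> K \<Longrightarrow> h k (w k) \<le> h k w'"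
    by metis
  \<comment> \<open>Comparison with the competitor \<open>wb\<close>, whose penalty is 0: the linear
    term can gain at most \<open>R * norm v\<close> on the ball.\<close>
  have pen: "(norm (xz_part (w k) - q))\<^sup>2 \<le> R * norm v * inverse (real (Suc k))" for k
  proof -
    have "real (Suc k) * (norm (xz_part (w k) - q))\<^sup>2 \<le> y_part (w k - wb) \<bullet> v"
      using min[OF \<open>wb \<in> K\<close>, of k] unfolding h_def power2_norm_eq_inner
      by (simp add: q_def linear_diff[OF y_part_linear] inner_diff_left)
    also have "\<dots> \<le> norm (y_part (w k - wb)) * norm v"
      by (rule norm_cauchy_schwarz)
    also have "\<dots> \<le> R * norm v"
      using wK[of k] norm_y_le[of "w k - wb"]
      by (intro mult_right_mono) (auto simp: K_def dist_norm norm_minus_commute)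
    finally show ?thesis
      by (simp add: field_simps)
  qed
  obtain l s where "l \<in> K" and s: "strict_mono s" and lim: "(w \<circ> s) \<longlonglongrightarrow> l"
    using K[THEN compact_imp_seq_compact] wK by (metis seq_compactE)
  have "(\<lambda>k. (norm (xz_part (w k) - q))\<^sup>2) \<longlonglongrightarrow> 0"
  proof (rule Lim_null_comparison[OF always_eventually])
    show "(\<lambda>k. R * norm v * inverse (real (Suc k))) \<longlonglongrightarrow> 0"
      by (intro tendsto_mult_right_zero LIMSEQ_inverse_real_of_nat)
  qed (use pen in auto)
  then have "(\<lambda>k. (norm (xz_part (w (s k)) - q))\<^sup>2) \<longlonglongrightarrow> 0"
    using LIMSEQ_subseq_LIMSEQ[OF _ s] by (fastforce simp: o_def)
  moreover have "(\<lambda>k. (norm (xz_part (w (s k)) - q))\<^sup>2) \<longlonglongrightarrow> (norm (xz_part l - q))\<^sup>2"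
    using bounded_linear.tendsto[OF bounded_linear_xz_part lim]
    by (intro tendsto_intros) (simp add: o_def)
  ultimately have "(norm (xz_part l - q))\<^sup>2 = 0"
    using LIMSEQ_unique by blast
  then have "l = wb"
    using \<open>l \<in> K\<close> by (intro unique) (auto simp: K_def q_def dist_commute)
  \<comment> \<open>The negative gradient of \<open>h k\<close> at \<open>w k\<close>.\<close>
  define \<nu> where "\<nu> k = y_embed v - (2 * real (Suc k)) *\<^sub>R xz_embed (xz_part (w k) - q)" for k
  have normal: "\<nu> k \<in> regular_normal_cone C (w k)" if "dist (w k) wb < R" for k
  proof -
    have "((\<lambda>w. xz_part w - q) has_derivative xz_part) (at (w k))"
      by (auto intro!: derivative_eq_intros bounded_linear_imp_has_derivative bounded_linear_xz_part)
    then have "(h k has_derivative (\<lambda>d. real (Suc k) * ((xz_part (w k) - q) \<bullet> xz_part d +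
        xz_part d \<bullet> (xz_part (w k) - q)) - y_part d \<bullet> v)) (at (w k))"
      unfolding h_def
      by (auto intro!: derivative_eq_intros bounded_linear_imp_has_derivative bounded_linear_y_part)
    then have "GDERIV (h k) (w k) :> - \<nu> k"
      unfolding gderiv_def
      by (rule has_derivative_eq_rhs)
        (simp add: fun_eq_iff inner_diff_right inner_xz_embed inner_y_embed \<nu>_def inner_commute algebra_simps)
    then have "- (- \<nu> k) \<in> regular_normal_cone C (w k)"
    proof (rule regular_normal_at_local_min)
      show "0 < R - dist (w k) wb"
        using that by simp
      show "h k (w k) \<le> h k w'" if "w' \<in> C" "dist w' (w k) < R - dist (w k) wb" for w'
        using that dist_triangle[of w' wb "w k"] by (intro min) (auto simp: K_def dist_commute)
    qed
    then show ?thesis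
      by simp
  qed
  have y\<nu>: "y_part (\<nu> k) = v" for k
    by (simp add: \<nu>_def linear_diff[OF y_part_linear] linear_cmul[OF y_part_linear] y_embed_def)
  \<comment> \<open>Below \<open>R\<close> the minimisers over \<open>K\<close> are local minimisers
    over \<open>C\<close>; below \<open>r0\<close> the estimate for normals applies. Hence the shift
    by \<open>N\<close>.\<close>
  have "\<forall>\<^sub>F k in sequentially. dist ((w \<circ> s) k) wb < min R r0"
    using tendstoD[OF lim, of "min R r0"] \<open>l = wb\<close> \<open>0 < R\<close> \<open>0 < r0\<close> by simp
  then obtain N where N: "\<And>k. N \<le> k \<Longrightarrow> dist (w (s k)) wb < min R r0"
    unfolding eventually_sequentially by auto
  define w' where "w' k = w (s (k + N))" for k
  define \<nu>' where "\<nu>' k = \<nu> (s (k + N))" for k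
  have \<nu>': "\<nu>' k \<in> regular_normal_cone C (w' k)" for k
    using normal N by (simp add: \<nu>'_def w'_def)
  \<comment> \<open>The factor \<open>2 * real (Suc k)\<close> grows, but the estimate bounds the
    (x, z) part by the fixed y part.\<close>
  have "norm (\<nu>' k) \<le> \<kappa> * norm v + norm v" for k
  proof -
    have "norm (xz_part (\<nu>' k)) \<le> \<kappa> * norm (y_part (\<nu>' k))"
      using bound(1) \<nu>'[of k] wK[of "s (k + N)"] N[of "k + N"]
      unfolding normals_bounded_by_y_def K_def w'_def by auto
    then show ?thesis
      using norm_le_xz_y[of "\<nu>' k"] y\<nu> by (simp add: \<nu>'_def)
  qed
  then have "bounded (range \<nu>')"
    unfolding bounded_iff by blast
  then obtain \<mu> t where t: "strict_mono t" and \<mu>: "(\<nu>' \<circ> t) \<longlonglongrightarrow> \<mu>"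
    using bounded_imp_convergent_subsequence by blast
  have "w' \<longlonglongrightarrow> wb"
    using LIMSEQ_ignore_initial_segment[OF lim, of N] \<open>l = wb\<close>
    by (simp add: w'_def[symmetric])
  then have "(w' \<circ> t) \<longlonglongrightarrow> wb"
    using t by (rule LIMSEQ_subseq_LIMSEQ)
  moreover have "(w' \<circ> t) k \<in> C" for k
    using wK by (simp add: w'_def K_def)
  ultimately have "\<mu> \<in> limiting_normal_cone C wb"
    using \<mu> \<nu>' unfolding limiting_normal_cone_def mem_Collect_eq
    by (intro exI[of _ "w' \<circ> t"] exI[of _ "\<nu>' \<circ> t"]) auto
  moreover have "y_part \<mu> = v"
    using bounded_linear.tendsto[OF bounded_linear_y_part \<mu>]
    by (simp add: \<nu>'_def y\<nu> LIMSEQ_const_iff)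
  ultimately show ?thesis
    by blast
qed

section \<open>Semismoothness of the composite function\<close>

lemma norm_blinfun_inner_right [simp]: "norm (blinfun_inner_right g) = norm g"
proof (rule antisym)
  show "norm (blinfun_inner_right g) \<le> norm g"
    by (rule norm_blinfun_bound) (simp_all add: Cauchy_Schwarz_ineq2)
  have "norm g * norm g \<le> norm (blinfun_inner_right g) * norm g"
    using norm_blinfun[of "blinfun_inner_right g" g]
    by (simp add: power2_norm_eq_inner[symmetric] power2_eq_square)
  then show "norm g \<le> norm (blinfun_inner_right g)"
    by (cases "g = 0") auto
qed

text \<open>Riesz representation in coordinates; it lets every element of \<open>\<Phi> p\<close> be
  read as a row vector.\<close>

lemma blinfun_inner_right_surj:
  fixes A :: "'a::euclidean_space \<Rightarrow>\<^sub>L real"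
  obtains g where "A = blinfun_inner_right g"
proof
  show "A = blinfun_inner_right (\<Sum>b\<in>Basis. blinfun_apply A b *\<^sub>R b)"
    by (rule blinfun_euclidean_eqI) (simp add: inner_sum_left inner_Basis sum.delta if_distrib cong: if_cong)
qed

text \<open>Both errors are small relative to \<open>norm (G u - G x)\<close>, which the Lipschitz
  bound compares with \<open>norm (u - x)\<close>. They are uniform over \<open>\<Theta> u\<close>
  because \<open>bound\<close> controls \<open>xs\<close> and \<open>zs\<close> by
  \<open>gy\<close>, and \<open>gy\<close> is bounded as \<open>\<Phi>\<close> is locally
  bounded.\<close>

lemma semismooth_wrt_compose_implicit:
  fixes F :: "'a::euclidean_space \<times> 'b::euclidean_space \<Rightarrow> 'c::euclidean_space set"
    and \<phi> :: "'a \<times> 'b \<Rightarrow> real"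
  assumes U: "open U" "x \<in> U" and lip: "L-lipschitz_on U \<sigma>"
    and sol: "\<And>u. u \<in> U \<Longrightarrow> 0 \<in> F (u, \<sigma> u)"
    and bound: "\<And>u gy xs zs. u \<in> U \<Longrightarrow> (xs, - gy) \<in> coderivative F (u, \<sigma> u) 0 zs \<Longrightarrow>
        norm xs \<le> \<kappa> * norm gy \<and> norm zs \<le> \<kappa> * norm gy" and "0 \<le> \<kappa>"
    and ne: "\<And>u gy. u \<in> U \<Longrightarrow> Sigma_map F u (\<sigma> u) gy \<noteq> {}"
    and ss: "semismooth_star F (x, \<sigma> x) 0"
    and ph: "semismooth_wrt UNIV \<phi> \<Phi> (x, \<sigma> x)"
  shows "semismooth_wrt U (\<lambda>u. \<phi> (u, \<sigma> u)) (Theta_map F \<sigma> \<Phi> U) x"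
proof -
  define G where "G u = (u, \<sigma> u)" for u
  have "0 \<le> L"
    using lip by (rule lipschitz_on_nonneg)
  have G_lip: "dist (G u) (G x) \<le> (1 + L) * dist u x" if "u \<in> U" for u
  proof -
    have "dist (G u) (G x) \<le> dist u x + dist (\<sigma> u) (\<sigma> x)"
      unfolding G_def dist_Pair_Pair by (rule sqrt_sum_squares_le_sum) auto
    then show ?thesis
      using lipschitz_onD[OF lip that U(2)] by (simp add: algebra_simps)
  qed
  have G_cont: "continuous_on U G"
    unfolding G_def using lipschitz_on_continuous_on[OF lip] by (intro continuous_intros)
  obtain N where N: "open N" "G x \<in> N" "bounded (\<Union>p\<in>N. \<Phi> p)"
    using ph unfolding semismooth_wrt_def locally_bounded_at_def G_def by blast
  then obtain B where B: "0 < B" "\<And>p A. p \<in> N \<Longrightarrow> A \<in> \<Phi> p \<Longrightarrow> norm A \<le> B"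
    unfolding bounded_pos by blast
  define W where "W = U \<inter> G -` (N \<inter> interior (mdom \<Phi>))"
  have "open W"
    unfolding W_def using N(1) by (intro continuous_open_preimage G_cont U) auto
  have "x \<in> W"
    using U N ph by (auto simp: W_def semismooth_wrt_def G_def)
  have "W \<subseteq> U"
    by (auto simp: W_def)
  have \<Theta>_ne: "Theta_map F \<sigma> \<Phi> U u \<noteq> {}" if "u \<in> W" for u
  proof -
    have "u \<in> U"
      using that \<open>W \<subseteq> U\<close> by blast
    have "\<Phi> (G u) \<noteq> {}"
      using that interior_subset[of "mdom \<Phi>"] by (auto simp: W_def mdom_def)
    then obtain gx gy where "blinfun_inner_right (gx, gy) \<in> \<Phi> (G u)"
      by (metis all_not_in_conv blinfun_inner_right_surj surj_pair)
    moreover obtain xs where "xs \<in> Sigma_map F u (\<sigma> u) gy"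
      using ne[OF \<open>u \<in> U\<close>] by blast
    ultimately show ?thesis
      using \<open>u \<in> U\<close> unfolding Theta_map_def G_def by auto
  qed
  \<comment> \<open>The bracket adds the bounds for \<open>gy\<close>, \<open>xs\<close> and
    \<open>zs\<close>.\<close>
  define K where "K = 1 + (B + \<kappa> * B + \<kappa> * B)"
  have "0 < K"
    using B(1) \<open>0 \<le> \<kappa>\<close> by (simp add: K_def add_pos_nonneg)
  \<comment> \<open>An elimination rule, shared by the error estimate and the proof of local
    boundedness.\<close>
  have \<Theta>_cases: thesis
    if mem: "A \<in> Theta_map F \<sigma> \<Phi> U u" and "u \<in> W"
      and *: "\<And>gx gy xs zs. A = blinfun_inner_right gx + blinfun_inner_right xs \<Longrightarrow>
        (xs, - gy) \<in> coderivative F (u, \<sigma> u) 0 zs \<Longrightarrow> blinfun_inner_right (gx, gy) \<in> \<Phi> (G u) \<Longrightarrow>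
        norm gx \<le> B \<Longrightarrow> norm xs \<le> \<kappa> * B \<Longrightarrow> norm (zs, xs, - gy) \<le> K \<Longrightarrow> thesis" for A u thesis
  proof -
    have "u \<in> U" "G u \<in> N"
      using \<open>u \<in> W\<close> by (auto simp: W_def)
    then obtain gx gy xs zs where A: "A = blinfun_inner_right gx + blinfun_inner_right xs"
      and co: "(xs, - gy) \<in> coderivative F (u, \<sigma> u) 0 zs"
      and g: "blinfun_inner_right (gx, gy) \<in> \<Phi> (G u)"
      using mem by (auto simp: Theta_map_def Sigma_map_def G_def)
    have "norm (gx, gy) \<le> B"
      using B(2)[OF \<open>G u \<in> N\<close> g] by simp
    then have gB: "norm gx \<le> B" "norm gy \<le> B"
      using norm_fst_le[of gx gy] norm_snd_le[of gy gx] by linarith+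
    have "\<kappa> * norm gy \<le> \<kappa> * B"
      using gB \<open>0 \<le> \<kappa>\<close> by (intro mult_left_mono) auto
    then have "norm xs \<le> \<kappa> * B" "norm zs \<le> \<kappa> * B"
      using bound[OF \<open>u \<in> U\<close> co] by auto
    moreover have "norm (zs, xs, - gy) \<le> norm zs + (norm xs + norm gy)"
      using norm_Pair_le[of zs "(xs, - gy)"] norm_Pair_le[of xs "- gy"] by simp
    ultimately show thesis
      using gB by (intro *[OF A co g, unfolded K_def]; linarith)
  qed
  have lim: "((\<lambda>u. (SUP A\<in>Theta_map F \<sigma> \<Phi> U u.
      norm (\<phi> (u, \<sigma> u) - \<phi> (x, \<sigma> x) - blinfun_apply A (u - x))) / norm (u - x)) \<longlongrightarrow> 0) (at x within U)"
  proof (rule tendstoI)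
    fix e :: real assume "0 < e"
    \<comment> \<open>The two errors together contribute
      \<open>(e1 + e2 * K) * (1 + L) = e / 2\<close>. The spare half restores strictness after the
      supremum is taken.\<close>
    define e1 where "e1 = e / (4 * (1 + L))"
    define e2 where "e2 = e1 / K"
    have "e1 * (1 + L) = e / 4" "e2 * K = e1"
      using \<open>0 < K\<close> \<open>0 \<le> L\<close> by (auto simp: e1_def e2_def divide_simps)
    then have "(e1 + e2 * K) * (1 + L) = e / 2"
      by (simp only: distrib_right)
    moreover have "0 < e1" "0 < e2"
      using \<open>0 < e\<close> \<open>0 < K\<close> \<open>0 \<le> L\<close> by (simp_all add: e1_def e2_def)
    ultimately have e12: "0 < e1" "0 < e2" "(e1 + e2 * K) * (1 + L) = e / 2"
      by blast+
    obtain d1 where d1: "0 < d1" "\<And>p. p \<noteq> G x \<Longrightarrow> dist p (G x) < d1 \<Longrightarrow>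
        \<bar>(SUP A\<in>\<Phi> p. norm (\<phi> p - \<phi> (G x) - blinfun_apply A (p - G x))) / norm (p - G x)\<bar> < e1"
      using ph tendstoD[of _ 0 "at (G x)" e1] e12(1)
      unfolding semismooth_wrt_def G_def eventually_at by (fastforce simp: dist_norm)
    \<comment> \<open>Both graph points have last component 0, so the term with \<open>ys\<close>
      vanishes and the distance reduces to \<open>norm (p - G x)\<close>.\<close>
    obtain d2 where d2: "0 < d2" "\<And>p ys xs. 0 \<in> F p \<Longrightarrow> norm (p - G x) \<le> d2 \<Longrightarrow>
        xs \<in> coderivative F p 0 ys \<Longrightarrow> \<bar>xs \<bullet> (p - G x)\<bar> \<le> e2 * norm (p - G x) * norm (ys, xs)"
    proof -
      obtain d where "0 < d" and d: "\<forall>p z. (p, z) \<in> gph F \<and> norm ((p, z) - (G x, 0)) \<le> d \<longrightarrow>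
        (\<forall>ys xs. (ys, xs) \<in> gph (coderivative F p z) \<longrightarrow>
           \<bar>xs \<bullet> (p - G x) - ys \<bullet> (z - 0)\<bar> \<le> e2 * norm ((p, z) - (G x, 0)) * norm (ys, xs))"
        using ss e12(2) unfolding semismooth_star_def G_def by meson
      show thesis
      proof (rule that[OF \<open>0 < d\<close>])
        fix p ys xs
        assume "0 \<in> F p" "norm (p - G x) \<le> d" "xs \<in> coderivative F p 0 ys"
        then show "\<bar>xs \<bullet> (p - G x)\<bar> \<le> e2 * norm (p - G x) * norm (ys, xs)"
          using d[rule_format, of p 0 ys xs] by (simp add: gph_def norm_Pair)
      qed
    qed
    have "\<forall>\<^sub>F u in at x within U. u \<in> W"
      using \<open>open W\<close> \<open>x \<in> W\<close> by (intro eventually_at_topological[THEN iffD2]) auto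
    moreover have "\<forall>\<^sub>F u in at x within U. dist (G u) (G x) < min d1 d2"
      using G_cont U(2) d1(1) d2(1) by (intro tendstoD) (auto simp: continuous_on_def)
    moreover have "\<forall>\<^sub>F u in at x within U. u \<noteq> x"
      by (auto simp: eventually_at_filter)
    ultimately show "\<forall>\<^sub>F u in at x within U. dist ((SUP A\<in>Theta_map F \<sigma> \<Phi> U u.
      norm (\<phi> (u, \<sigma> u) - \<phi> (x, \<sigma> x) - blinfun_apply A (u - x))) / norm (u - x)) 0 < e"
    proof eventually_elim
      case (elim u)
      define D where "D = norm (G u - G x)"
      have "u \<in> U" "G u \<in> N"
        using elim by (auto simp: W_def)
      have "G u \<noteq> G x"
        using elim by (simp add: G_def)
      have D: "D < d1" "D < d2" "0 < D"
        using elim \<open>G u \<noteq> G x\<close> by (auto simp: D_def dist_norm)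
      have DL: "D \<le> (1 + L) * norm (u - x)"
        using G_lip[OF \<open>u \<in> U\<close>] by (simp add: D_def dist_norm)
      have D_bound: "norm (\<phi> (G u) - \<phi> (G x) - blinfun_apply A (G u - G x)) \<le> e1 * D"
        if "A \<in> \<Phi> (G u)" for A
      proof -
        let ?f = "\<lambda>A. norm (\<phi> (G u) - \<phi> (G x) - blinfun_apply A (G u - G x))"
        have "?f A \<le> \<bar>\<phi> (G u) - \<phi> (G x)\<bar> + B * D" if "A \<in> \<Phi> (G u)" for A
        proof -
          have "norm A * D \<le> B * D"
            using B(2)[OF \<open>G u \<in> N\<close> that] D by (intro mult_right_mono) auto
          then show ?thesis
            using norm_blinfun[of A "G u - G x"] unfolding D_def real_norm_def by linarith
        qed
        \<comment> \<open>A real supremum dominates its members only over a set bounded above; local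
          boundedness of \<open>\<Phi>\<close> provides this.\<close>
        then have "bdd_above (?f ` \<Phi> (G u))"
          by (rule bdd_aboveI2)
        then have "?f A \<le> (SUP A\<in>\<Phi> (G u). ?f A)"
          using that by (intro cSUP_upper)
        also have "\<dots> \<le> e1 * D"
          using d1(2)[OF \<open>G u \<noteq> G x\<close>] elim D by (simp add: D_def[symmetric] divide_simps abs_less_iff)
        finally show ?thesis .
      qed
      have A_bound: "norm (\<phi> (u, \<sigma> u) - \<phi> (x, \<sigma> x) - blinfun_apply A (u - x)) \<le> e / 2 * norm (u - x)"
        if A: "A \<in> Theta_map F \<sigma> \<Phi> U u" for A
        using A elim(1)
      proof (rule \<Theta>_cases)
        fix gx gy xs zs
        assume A: "A = blinfun_inner_right gx + blinfun_inner_right xs"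
          and co: "(xs, - gy) \<in> coderivative F (u, \<sigma> u) 0 zs"
          and g: "blinfun_inner_right (gx, gy) \<in> \<Phi> (G u)"
          and K: "norm (zs, xs, - gy) \<le> K"
        have "\<bar>(xs, - gy) \<bullet> (G u - G x)\<bar> \<le> e2 * D * norm (zs, (xs, - gy))"
          using d2(2)[of "G u" "(xs, - gy)" zs] co sol[OF \<open>u \<in> U\<close>] D by (simp add: D_def G_def)
        also have "\<dots> \<le> e2 * D * K"
          using K e12 D by (intro mult_left_mono) auto
        finally have 2: "\<bar>xs \<bullet> (u - x) - gy \<bullet> (\<sigma> u - \<sigma> x)\<bar> \<le> e2 * D * K"
          by (simp add: G_def)
        have 1: "\<bar>\<phi> (G u) - \<phi> (G x) - (gx \<bullet> (u - x) + gy \<bullet> (\<sigma> u - \<sigma> x))\<bar> \<le> e1 * D"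
          using D_bound[OF g] by (simp add: G_def)
        \<comment> \<open>The term \<open>gy \<bullet> (\<sigma> u - \<sigma> x)\<close> is
          subtracted in one error and restored by the other.\<close>
        have "norm (\<phi> (u, \<sigma> u) - \<phi> (x, \<sigma> x) - blinfun_apply A (u - x))
            = \<bar>(\<phi> (G u) - \<phi> (G x) - (gx \<bullet> (u - x) + gy \<bullet> (\<sigma> u - \<sigma> x)))
                - (xs \<bullet> (u - x) - gy \<bullet> (\<sigma> u - \<sigma> x))\<bar>"
          by (simp add: A blinfun.add_left G_def)
        also have "\<dots> \<le> (e1 + e2 * K) * D"
          using 1 2 by (simp add: algebra_simps)
        also have "\<dots> \<le> (e1 + e2 * K) * ((1 + L) * norm (u - x))"
          using DL e12 \<open>0 < K\<close> by (intro mult_left_mono) auto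
        also have "\<dots> = e / 2 * norm (u - x)"
          by (simp only: mult.assoc[symmetric] e12(3))
        finally show ?thesis .
      qed
      have "\<bar>SUP A\<in>Theta_map F \<sigma> \<Phi> U u. norm (\<phi> (u, \<sigma> u) - \<phi> (x, \<sigma> x) - blinfun_apply A (u - x))\<bar>
          \<le> e / 2 * norm (u - x)"
        using \<Theta>_ne[OF elim(1)] A_bound by (intro cSup_abs_le) auto
      also have "\<dots> < e * norm (u - x)"
        using \<open>0 < e\<close> elim by simp
      finally show ?case
        using elim by (simp add: divide_simps)
    qed
  qed
  have "W \<subseteq> mdom (Theta_map F \<sigma> \<Phi> U)"
    using \<Theta>_ne by (auto simp: mdom_def)
  then have "x \<in> interior (mdom (Theta_map F \<sigma> \<Phi> U))"
    using \<open>open W\<close> \<open>x \<in> W\<close> by (rule interiorI[rotated 2])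
  moreover have "norm A \<le> B + \<kappa> * B" if A: "A \<in> Theta_map F \<sigma> \<Phi> U u" and "u \<in> W" for A u
    using that
  proof (rule \<Theta>_cases)
    fix gx xs :: 'a
    assume "A = blinfun_inner_right gx + blinfun_inner_right xs" "norm gx \<le> B" "norm xs \<le> \<kappa> * B"
    then show ?thesis
      using norm_triangle_ineq[of "blinfun_inner_right gx" "blinfun_inner_right xs"] by simp
  qed
  then have "bounded (\<Union>u\<in>W. Theta_map F \<sigma> \<Phi> U u)"
    unfolding bounded_iff by blast
  then have "locally_bounded_at (Theta_map F \<sigma> \<Phi> U) x"
    unfolding locally_bounded_at_def using \<open>open W\<close> \<open>x \<in> W\<close> by blast
  ultimately show ?thesis
    using U lim unfolding semismooth_wrt_def by blast
qed

section \<open>Regularity of the implicit map and nonemptiness of its generalized derivative\<close>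

text \<open>Metric regularity moves the graph point over \<open>(a, 0)\<close> to one over
  \<open>(b, 0)\<close> at distance at most \<open>M * dist a b\<close>. By local uniqueness this is
  the graph point of \<open>\<sigma> b\<close>, so \<open>\<sigma>\<close> is Lipschitz. Local
  uniqueness also isolates \<open>w u\<close> in its fibre, as the construction of normals with
  prescribed y part demands.\<close>

lemma implicit_map_regularity:
  fixes F :: "'a::euclidean_space \<times> 'b::euclidean_space \<Rightarrow> 'c::euclidean_space set"
  assumes closed: "locally_closed_at (gph F) ((xb, yb), 0)"
    and sol: "(xb, yb) \<in> gph (solution_map F)"
    and nbhd: "open \<Omega>" "open V" "xb \<in> \<Omega>" "yb \<in> V"
    and graph: "gph (solution_map F) \<inter> (\<Omega> \<times> V) = {(x, \<sigma> x) | x. x \<in> \<Omega>}"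
    and cont: "continuous_on \<Omega> \<sigma>"
    and qc: "\<And>xs zs. (xs, 0) \<in> coderivative F (xb, yb) 0 zs \<Longrightarrow> zs = 0 \<and> xs = 0"
  obtains U L \<kappa> where "open U" "xb \<in> U" "U \<subseteq> \<Omega>" "L-lipschitz_on U \<sigma>" "0 \<le> \<kappa>"
    "\<And>u ys xs zs. u \<in> U \<Longrightarrow> (xs, - ys) \<in> coderivative F (u, \<sigma> u) 0 zs \<Longrightarrow>
        norm xs \<le> \<kappa> * norm ys \<and> norm zs \<le> \<kappa> * norm ys"
    "\<And>u ys. u \<in> U \<Longrightarrow> Sigma_map F u (\<sigma> u) ys \<noteq> {}"
proof -
  define C where "C = gph F"
  define wb where "wb = ((xb, yb), 0::'c)"
  define w where "w u = ((u, \<sigma> u), 0::'c)" for u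
  have solution: "w u \<in> C" if "u \<in> \<Omega>" for u
    using that graph by (auto simp: C_def w_def gph_def solution_map_def)
  have y_unique: "y = \<sigma> u" if "((u, y), 0) \<in> C" "u \<in> \<Omega>" "y \<in> V" for u y
  proof -
    have "(u, y) \<in> gph (solution_map F) \<inter> (\<Omega> \<times> V)"
      using that by (simp add: C_def gph_def solution_map_def)
    then show ?thesis
      unfolding graph by blast
  qed
  have "((xb, yb), 0) \<in> C"
    using sol by (simp add: C_def gph_def solution_map_def)
  then have "\<sigma> xb = yb"
    using y_unique nbhd by metis
  then have w_xb: "w xb = wb"
    by (simp add: w_def wb_def)
  obtain R where R: "0 < R" "closed (C \<inter> cball wb R)"
    using assms(1) unfolding locally_closed_at_def C_def wb_def by blast
  obtain \<kappa> r where \<kappa>: "0 < \<kappa>" "0 < r" and bound: "normals_bounded_by_y C \<kappa> wb r"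
  proof (rule obtain_normals_bounded_by_y)
    fix \<nu> assume \<nu>: "\<nu> \<in> limiting_normal_cone C wb" "y_part \<nu> = 0"
    obtain a b c where abc: "\<nu> = ((a, b), c)"
      by (metis surj_pair)
    \<comment> \<open>The last component of a normal is minus the argument of the
      coderivative.\<close>
    then have "(a, 0) \<in> coderivative F (xb, yb) 0 (- c)"
      using \<nu> by (simp add: coderivative_def C_def wb_def)
    then have "- c = 0 \<and> a = 0"
      by (rule qc)
    then show "\<nu> = 0"
      using abc \<nu>(2) by (simp add: zero_prod_def)
  qed
  obtain M s where M: "0 < M" "0 < s" and regular:
    "\<And>w0 q. w0 \<in> C \<Longrightarrow> dist w0 wb < s \<Longrightarrow> norm (xz_part w0 - q) < s \<Longrightarrow>
       \<exists>w1\<in>C. xz_part w1 = q \<and> dist w1 w0 \<le> M * norm (xz_part w0 - q)"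
    using projection_metric_regular[OF R(2,1) bound \<kappa>] by blast
  obtain e where e: "0 < e" "ball yb e \<subseteq> V"
    using nbhd open_contains_ball by blast
  have y_near: "w u = ((u, y), 0)" if "((u, y), 0) \<in> C" "u \<in> \<Omega>" "dist ((u, y), 0) wb < e" for u y
  proof -
    have "norm (snd (fst (((u, y), 0::'c) - wb))) \<le> norm (((u, y), 0) - wb)"
      by (rule norm_y_le[unfolded y_part_def])
    then have "dist y yb < e"
      using that(3) by (simp add: wb_def dist_norm)
    then have "y \<in> V"
      using e(2) by (auto simp: dist_commute)
    then show ?thesis
      using y_unique[OF that(1,2)] by (simp add: w_def)
  qed
  \<comment> \<open>Halving leaves room for balls around \<open>w u\<close> inside those of radius
    \<open>R\<close> and \<open>e\<close> around \<open>wb\<close>.\<close>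
  define \<eta> where "\<eta> = min (min r s) (min R e) / 2"
  have \<eta>: "0 < \<eta>" "\<eta> < r" "\<eta> < s" "\<eta> \<le> R / 2" "\<eta> \<le> e / 2"
    using \<kappa> M R e by (auto simp: \<eta>_def)
  have "continuous_on \<Omega> w"
    unfolding w_def by (intro continuous_intros cont)
  then have "open (\<Omega> \<inter> w -` ball wb \<eta>)"
    using nbhd by (intro continuous_open_preimage) auto
  moreover have "xb \<in> \<Omega> \<inter> w -` ball wb \<eta>"
    using nbhd w_xb \<eta> by simp
  ultimately obtain d where d: "0 < d" "ball xb d \<subseteq> \<Omega> \<inter> w -` ball wb \<eta>"
    using open_contains_ball by blast
  \<comment> \<open>Points of \<open>U\<close> are less than \<open>2 * \<delta> \<le> s\<close>
    apart, and the lifted point moves by at most \<open>M * (2 * \<delta>) \<le> e / 2\<close>, so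
    it stays in the region of uniqueness.\<close>
  define \<delta> where "\<delta> = min d (min (s / 2) (e / (4 * M)))"
  have \<delta>: "0 < \<delta>" "\<delta> \<le> d" "\<delta> \<le> s / 2" "M * \<delta> \<le> e / 4"
  proof -
    show "0 < \<delta>" "\<delta> \<le> d" "\<delta> \<le> s / 2"
      using d M e by (auto simp: \<delta>_def)
    have "M * \<delta> \<le> M * (e / (4 * M))"
      using M by (intro mult_left_mono) (auto simp: \<delta>_def)
    then show "M * \<delta> \<le> e / 4"
      using M by simp
  qed
  define U where "U = ball xb \<delta>"
  have U: "u \<in> \<Omega>" "dist (w u) wb < \<eta>" if "u \<in> U" for u
  proof -
    have "u \<in> ball xb d"
      using that \<delta>(2) by (simp add: U_def)
    then have "u \<in> \<Omega> \<inter> w -` ball wb \<eta>"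
      using d(2) by blast
    then show "u \<in> \<Omega>" "dist (w u) wb < \<eta>"
      by (simp_all add: dist_commute)
  qed
  have lipschitz: "M-lipschitz_on U \<sigma>"
  proof (rule lipschitz_onI)
    fix a b assume "a \<in> U" "b \<in> U"
    have "dist a b < 2 * \<delta>"
      using \<open>a \<in> U\<close> \<open>b \<in> U\<close> dist_triangle[of a b xb] by (simp add: U_def dist_commute)
    have ab: "norm (xz_part (w a) - (b, 0)) = dist a b"
      by (simp add: w_def dist_norm norm_Pair)
    have "dist (w a) wb < s" "norm (xz_part (w a) - (b, 0)) < s"
      using U(2)[OF \<open>a \<in> U\<close>] \<eta> \<delta>(3) \<open>dist a b < 2 * \<delta>\<close> unfolding ab by linarith+
    then obtain w1 where w1: "w1 \<in> C" "xz_part w1 = (b, 0)" "dist w1 (w a) \<le> M * dist a b"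
      using regular[OF solution[OF U(1)[OF \<open>a \<in> U\<close>]], of "(b, 0)"]
      unfolding ab by blast
    then obtain y where y: "w1 = ((b, y), 0)"
      by (cases w1, cases "fst w1") auto
    have "M * dist a b \<le> M * (2 * \<delta>)"
      using \<open>dist a b < 2 * \<delta>\<close> M by (intro mult_left_mono) auto
    then have "dist w1 wb < e"
      using w1(3) dist_triangle[of w1 wb "w a"] U(2)[OF \<open>a \<in> U\<close>] \<eta> \<delta>(4) by linarith
    then have "w b = w1"
      using y_near[of b y] w1(1) U(1)[OF \<open>b \<in> U\<close>] unfolding y by simp
    have "norm (snd (fst (w b - w a))) \<le> norm (w b - w a)"
      by (rule norm_y_le[unfolded y_part_def])
    then have "dist (\<sigma> a) (\<sigma> b) \<le> dist (w b) (w a)"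
      by (simp add: w_def dist_norm norm_minus_commute)
    then show "dist (\<sigma> a) (\<sigma> b) \<le> M * dist a b"
      using w1(3) \<open>w b = w1\<close> by simp
  qed (use M in simp)
  have coderivative_bound: "norm xs \<le> \<kappa> * norm ys \<and> norm zs \<le> \<kappa> * norm ys"
    if "u \<in> U" and "(xs, - ys) \<in> coderivative F (u, \<sigma> u) 0 zs" for u ys xs zs
  proof -
    have "((xs, - ys), - zs) \<in> limiting_normal_cone C (w u)"
      using that(2) by (simp add: coderivative_def C_def w_def)
    moreover have "dist (w u) wb < r"
      using U(2)[OF that(1)] \<eta> by simp
    ultimately have "norm (xs, - zs) \<le> \<kappa> * norm ys"
      using limiting_normal_bound[OF bound] by fastforce
    then show ?thesis
      using norm_fst_le[of xs "- zs"] norm_snd_le[of "- zs" xs] by simp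
  qed
  have Sigma_nonempty: "Sigma_map F u (\<sigma> u) ys \<noteq> {}" if "u \<in> U" for u ys
  proof -
    define R' where "R' = min R e / 4"
    have R': "0 < R'" "R' + \<eta> \<le> R" "R' + \<eta> < e"
      using R(1) e(1) \<eta> by (auto simp: R'_def)
    note near = U(2)[OF that]
    have "\<exists>\<nu>\<in>limiting_normal_cone C (w u). y_part \<nu> = - ys"
    proof (rule limiting_normal_with_y_part)
      have "cball (w u) R' \<subseteq> cball wb R"
        using near R' by (simp add: cball_subset_cball_iff)
      then have "C \<inter> cball (w u) R' = (C \<inter> cball wb R) \<inter> cball (w u) R'"
        by blast
      then show "closed (C \<inter> cball (w u) R')"
        using R(2) by (metis closed_Int closed_cball)
      show "w u \<in> C"
        by (rule solution[OF U(1)[OF that]])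
      show "0 < r - dist (w u) wb"
        using near \<eta> by simp
      show "normals_bounded_by_y C \<kappa> (w u) (r - dist (w u) wb)"
        unfolding normals_bounded_by_y_def
      proof (intro ballI impI)
        fix w' \<nu> assume w': "w' \<in> C" "dist w' (w u) < r - dist (w u) wb"
          and "\<nu> \<in> regular_normal_cone C w'"
        moreover have "dist w' wb < r"
          using w'(2) dist_triangle[of w' wb "w u"] by linarith
        ultimately show "norm (xz_part \<nu>) \<le> \<kappa> * norm (y_part \<nu>)"
          using bound unfolding normals_bounded_by_y_def by blast
      qed
      show "w' = w u" if w': "w' \<in> C" "dist w' (w u) \<le> R'" "xz_part w' = xz_part (w u)" for w'
      proof -
        obtain y where y: "w' = ((u, y), 0)"
          using w'(3) by (cases w', cases "fst w'") (auto simp: w_def)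
        have "dist w' wb < e"
          using w'(2) near R'(3) dist_triangle[of w' wb "w u"] by linarith
        then show ?thesis
          using y_near[of u y] w'(1) U(1)[OF \<open>u \<in> U\<close>] unfolding y by simp
      qed
    qed (rule R'(1))
    then obtain a c where "((a, - ys), c) \<in> limiting_normal_cone C (w u)"
      by (metis surj_pair y_part_simps)
    then have "(a, - ys) \<in> coderivative F (u, \<sigma> u) 0 (- c)"
      by (simp add: coderivative_def C_def w_def)
    then show ?thesis
      unfolding Sigma_map_def by blast
  qed
  show thesis
  proof (rule that)
    show "open U" "xb \<in> U"
      using \<delta>(1) by (simp_all add: U_def)
    show "U \<subseteq> \<Omega>"
      using U(1) by blast
    show "0 \<le> \<kappa>"
      using \<kappa>(1) by simp
  qed (fact lipschitz coderivative_bound Sigma_nonempty)+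
qed

theorem theorem5p3:
  fixes F :: "(real ^ 'n) \<times> (real ^ 'm) \<Rightarrow> (real ^ 'l) set"
    and xb :: "real ^ 'n" and yb :: "real ^ 'm"
    and \<Omega> :: "(real ^ 'n) set" and V :: "(real ^ 'm) set"
    and \<sigma> :: "real ^ 'n \<Rightarrow> real ^ 'm"
  assumes closed: "locally_closed_at (gph F) ((xb, yb), 0)"
    and sol: "(xb, yb) \<in> gph (solution_map F)"
    and qc: "\<And>zs. (0, 0) \<in> coderivative F (xb, yb) 0 zs \<Longrightarrow> zs = 0"
    and nbhd: "open \<Omega>" "open V" "xb \<in> \<Omega>" "yb \<in> V"
    and graph: "gph (solution_map F) \<inter> (\<Omega> \<times> V) = {(x, \<sigma> x) | x. x \<in> \<Omega>}"
    and cont: "continuous_on \<Omega> \<sigma>"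
    and strong_qc: "\<And>xs zs. (xs, 0) \<in> coderivative F (xb, yb) 0 zs \<Longrightarrow> zs = 0 \<and> xs = 0"
  shows "\<exists>U. open U \<and> xb \<in> U \<and> U \<subseteq> \<Omega> \<and> (\<exists>L. L-lipschitz_on U \<sigma>) \<and>
           (\<forall>x\<in>U. semismooth_star F (x, \<sigma> x) 0 \<longrightarrow>
              (\<forall>(\<phi> :: (real ^ 'n) \<times> (real ^ 'm) \<Rightarrow> real)
                (\<Phi> :: (real ^ 'n) \<times> (real ^ 'm) \<Rightarrow> (((real ^ 'n) \<times> (real ^ 'm)) \<Rightarrow>\<^sub>L real) set).
                 semismooth_wrt UNIV \<phi> \<Phi> (x, \<sigma> x) \<longrightarrow>
                 semismooth_wrt U (\<lambda>u. \<phi> (u, \<sigma> u)) (Theta_map F \<sigma> \<Phi> U) x))"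
proof -
  obtain U L \<kappa> where U: "open U" "xb \<in> U" "U \<subseteq> \<Omega>" and lip: "L-lipschitz_on U \<sigma>" and "0 \<le> \<kappa>"
    and bound: "\<And>u ys xs zs. u \<in> U \<Longrightarrow> (xs, - ys) \<in> coderivative F (u, \<sigma> u) 0 zs \<Longrightarrow>
        norm xs \<le> \<kappa> * norm ys \<and> norm zs \<le> \<kappa> * norm ys"
    and ne: "\<And>u ys. u \<in> U \<Longrightarrow> Sigma_map F u (\<sigma> u) ys \<noteq> {}"
    \<comment> \<open>\<open>U\<close> is fixed here, before \<open>x\<close>, \<open>\<phi>\<close>
      and \<open>\<Phi>\<close> are chosen, so one neighbourhood serves them all.\<close>
    using implicit_map_regularity[OF closed sol nbhd graph cont strong_qc] by blast
  have "0 \<in> F (u, \<sigma> u)" if "u \<in> U" for u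
    using graph U(3) that by (auto simp: gph_def solution_map_def)
  note compose = semismooth_wrt_compose_implicit[OF U(1) _ lip this bound \<open>0 \<le> \<kappa>\<close> ne]
  show ?thesis
    by (intro exI[of _ U] conjI ballI allI impI exI[of _ L] U lip compose)
qed

end
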